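(* A directed graph $G=(V,E)$ is isomorphic to the transition graph of some reaction system if and only if the following three conditions hold: (1) $|V|=2^n$ for some $n\ge1$; (2) there is a faithful correspondence $\eta$ between $\mathcal O(G)$ and a family of upper cones of $(2^{[n]},\subseteq)$, i.e. a family $\mathrm{Up}[R]$ for some $R\subseteq 2^{[n]}$; (3) there are a vertex $v_\bot\in V\setminus\bigcup\{X\in\mathcal O(G)\mid X\neq V\}$ and a vertex $v_\top\in\bigcap\mathcal O(G)$ such that $(v_\bot,v_\bot)$ and $(v_\top,v_\bot)$ are edges of $G$.
   Context: $[n]=\{0,1,\dots,n-1\}$. For a directed graph $G=(V,E)$, $\mathrm{out}_G(v)=\{w\mid (v,w)\in E\}$ and $\mathcal O(G)=\{\mathrm{out}_G(v)\mid v\in V\}$. In the poset $(2^{[n]},\subseteq)$, $\mathrm{Up}(X)=\{Y\subseteq[n]\mid X\subseteq Y\}$ and $\mathrm{Up}[R]=\{\mathrm{Up}(X)\mid X\in R\}$. For a family $\mathcal O$, $\mathcal O^\cap$ is the smallest family containing $\mathcal O$ closed under intersection of two sets; a faithful correspondence between $\mathcal O_1$ and $\mathcal O_2$ is a bijection $\eta:\mathcal O_1^\cap\to\mathcal O_2^\cap$ with $|X|=|\eta(X)|$ and $\eta(X\cap Y)=\eta(X)\cap\eta(Y)$ for all $X,Y\in\mathcal O_1^\cap$. A reaction system is a pair $\mathcal A=(S,A)$ with $S$ a finite set and $A\subseteq(2^S\setminus\{\varnothing\})\times(2^S\setminus\{\varnothing\})\times 2^S$ a set of reactions $(R,I,P)$;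 $a=(R,I,P)$ is enabled in $X\subseteq S$ iff $R\subseteq X$ and $I\cap X=\varnothing$; $\mathrm{res}_a(X)=P$ if enabled and $\varnothing$ otherwise; $\mathrm{res}_{\mathcal A}(X)=\bigcup_{a\in A}\mathrm{res}_a(X)$. The transition graph of $\mathcal A$ is $G_{\mathcal A}$ with vertex set $2^S$ and edge set $\{(v,w)\mid v,w\in 2^S,\ \mathrm{res}_{\mathcal A}(v)\subseteq w\}$.
   Formalization: The background set S of the reaction system is required to be nonempty (for S empty the transition graph is a single vertex with a loop, |V|=2^0, and condition (1) fails), and S is taken, up to renaming, as a finite set of natural numbers. *)

theory Defs
  imports
    "HOL-Library.Equipollence"
    "Graph_Theory.Pair_Digraph"
    "Graph_Theory.Digraph_Isomorphism"
begin

definition out_set :: "'a pair_pre_digraph \<Rightarrow> 'a \<Rightarrow> 'a set" where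
  "out_set G v = {w. (v, w) \<in> parcs G}"

definition out_sets :: "'a pair_pre_digraph \<Rightarrow> 'a set set" where
  "out_sets G = out_set G ` pverts G"

text \<open>Here \<open>{..<n}\<close> plays the role of \<open>[n] = {0, \<dots>, n - 1}\<close>.\<close>

definition upper_cone :: "nat \<Rightarrow> nat set \<Rightarrow> nat set set" where
  "upper_cone n X = {Y \<in> Pow {..<n}. X \<subseteq> Y}"

text \<open>Only binary intersections: the empty intersection is not added.\<close>

inductive_set inter_closure :: "'a set set \<Rightarrow> 'a set set" for F where
  base: "X \<in> F \<Longrightarrow> X \<in> inter_closure F"
| inter: "X \<in> inter_closure F \<Longrightarrow> Y \<in> inter_closure F \<Longrightarrow> X \<inter> Y \<in> inter_closure F"

text \<open>Sizes are compared by equipollence, so that the condition is also meaningful for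
  infinite sets, on which \<open>card\<close> is constantly \<open>0\<close>.\<close>

definition faithful_correspondence ::
    "('a set \<Rightarrow> 'b set) \<Rightarrow> 'a set set \<Rightarrow> 'b set set \<Rightarrow> bool" where
  "faithful_correspondence \<eta> F1 F2 \<longleftrightarrow>
     bij_betw \<eta> (inter_closure F1) (inter_closure F2) \<and>
     (\<forall>X \<in> inter_closure F1. X \<approx> \<eta> X) \<and>
     (\<forall>X \<in> inter_closure F1. \<forall>Y \<in> inter_closure F1. \<eta> (X \<inter> Y) = \<eta> X \<inter> \<eta> Y)"

text \<open>A reaction is a triple \<open>(R, I, P)\<close> of reactants, inhibitors and products; a reaction
  system is a pair \<open>(S, A)\<close> of a background set and a set of reactions.
  An empty background set is allowed; its transition graph is a single vertex with a loop.\<close>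

type_synonym 's reaction = "'s set \<times> 's set \<times> 's set"
type_synonym 's reaction_sys = "'s set \<times> 's reaction set"

fun reaction_system :: "'s reaction_sys \<Rightarrow> bool" where
  "reaction_system (S, A) \<longleftrightarrow>
     finite S \<and> A \<subseteq> (Pow S - {{}}) \<times> (Pow S - {{}}) \<times> Pow S"

fun enabled :: "'s reaction \<Rightarrow> 's set \<Rightarrow> bool" where
  "enabled (R, I, P) X \<longleftrightarrow> R \<subseteq> X \<and> I \<inter> X = {}"

fun res_reaction :: "'s reaction \<Rightarrow> 's set \<Rightarrow> 's set" where
  "res_reaction (R, I, P) X = (if enabled (R, I, P) X then P else {})"

fun res :: "'s reaction_sys \<Rightarrow> 's set \<Rightarrow> 's set" where
  "res (S, A) X = (\<Union>a\<in>A. res_reaction a X)"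

fun transition_graph :: "'s reaction_sys \<Rightarrow> 's set pair_pre_digraph" where
  "transition_graph (S, A) =
     \<lparr> pverts = Pow S,
       parcs = {(v, w). v \<in> Pow S \<and> w \<in> Pow S \<and> res (S, A) v \<subseteq> w} \<rparr>"

end

theory Submission
  imports Defs "HOL-Combinatorics.Transposition"
begin

text \<open>The transition graph of a reaction system is determined by its result function, and
  every function \<open>f\<close> on \<open>2\<^sup>S\<close> with \<open>f {} = f S = {}\<close> is a result function: use the reactions
  \<open>(X, S - X, f X)\<close>. So a graph is a transition graph iff its vertices can be labelled
  bijectively by subsets of \<open>[n]\<close> such that every out-neighbourhood becomes an upper cone, which is
  the full cone at the vertices labelled \<open>{}\<close> and \<open>[n]\<close>.

  Given a faithful correspondence, inclusion-exclusion shows that each pattern of membership in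
  the out-neighbourhoods is realised by as many vertices of \<open>G\<close> as the pattern of membership in
  the corresponding cones is realised by subsets of \<open>[n]\<close>. Hence a labelling that induces the
  correspondence exists. It can be composed with transpositions within a pattern so that
  \<open>v\<^sub>\<bottom>\<close> and \<open>v\<^sub>\<top>\<close> are labelled \<open>{}\<close> and \<open>[n]\<close>.\<close>

section \<open>Bijections with prescribed membership patterns\<close>

text \<open>Inclusion-exclusion as a recursion on \<open>N\<close>, for all \<open>T\<close> at
  once: putting \<open>j\<close> into \<open>N\<close> subtracts the points that also lie in the
  \<open>j\<close>-th set, a count with \<open>j\<close> in \<open>T\<close> instead. So the counts
  with empty \<open>N\<close> determine all others.\<close>

lemma card_pattern_eq:
  fixes A :: "'i \<Rightarrow> 'a set" and B :: "'i \<Rightarrow> 'b set"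
  assumes "finite V" "finite W" "finite N"
    and inters: "\<And>J. J \<subseteq> I \<Longrightarrow>
      card {v \<in> V. \<forall>i\<in>J. v \<in> A i} = card {w \<in> W. \<forall>i\<in>J. w \<in> B i}"
    and "N \<subseteq> I" "T \<subseteq> I"
  shows "card {v \<in> V. (\<forall>i\<in>T. v \<in> A i) \<and> (\<forall>i\<in>N. v \<notin> A i)}
    = card {w \<in> W. (\<forall>i\<in>T. w \<in> B i) \<and> (\<forall>i\<in>N. w \<notin> B i)}"
  using \<open>finite N\<close> \<open>N \<subseteq> I\<close> \<open>T \<subseteq> I\<close>
proof (induction N arbitrary: T rule: finite_induct)
  case empty
  then show ?case using inters by simp
next
  case (insert j N)
  \<comment> \<open>The recursion is stated for any type, as it is applied both to \<open>V\<close>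
    with \<open>A\<close> and to \<open>W\<close> with \<open>B\<close>.\<close>
  have split: "card {x \<in> U. (\<forall>i\<in>T. x \<in> C i) \<and> (\<forall>i\<in>insert j N. x \<notin> C i)}
      = card {x \<in> U. (\<forall>i\<in>T. x \<in> C i) \<and> (\<forall>i\<in>N. x \<notin> C i)}
        - card {x \<in> U. (\<forall>i\<in>insert j T. x \<in> C i) \<and> (\<forall>i\<in>N. x \<notin> C i)}"
    if "finite U" for U :: "'c set" and C :: "'i \<Rightarrow> 'c set"
  proof -
    let ?P = "{x \<in> U. (\<forall>i\<in>T. x \<in> C i) \<and> (\<forall>i\<in>N. x \<notin> C i)}"
    let ?Q = "{x \<in> U. (\<forall>i\<in>insert j T. x \<in> C i) \<and> (\<forall>i\<in>N. x \<notin> C i)}"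
    have "{x \<in> U. (\<forall>i\<in>T. x \<in> C i) \<and> (\<forall>i\<in>insert j N. x \<notin> C i)} = ?P - ?Q"
      by auto
    moreover have "finite ?Q" "?Q \<subseteq> ?P"
      using that by auto
    ultimately show ?thesis by (simp add: card_Diff_subset)
  qed
  show ?case
    using insert.prems
    by (simp only: split[OF \<open>finite V\<close>] split[OF \<open>finite W\<close>] insert.IH insert_subset simp_thms)
qed

text \<open>Bijections between the fibres over each \<open>c\<close> are glued. The result is
  injective because \<open>g\<close> recovers the fibre from the image.\<close>

lemma ex_bij_betw_fibres:
  assumes "finite V" "finite W"
    and "\<And>c. card {v \<in> V. f v = c} = card {w \<in> W. g w = c}"
  obtains \<phi> where "bij_betw \<phi> V W" "\<And>v. v \<in> V \<Longrightarrow> g (\<phi> v) = f v"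
proof -
  have "\<exists>h. bij_betw h {v \<in> V. f v = c} {w \<in> W. g w = c}" for c
    using assms by (intro finite_same_card_bij) auto
  then obtain h where h: "\<And>c. bij_betw (h c) {v \<in> V. f v = c} {w \<in> W. g w = c}"
    by metis
  have mem: "h (f v) v \<in> W \<and> g (h (f v) v) = f v" if "v \<in> V" for v
    using bij_betwE[OF h, of "f v"] that by blast
  have "bij_betw (\<lambda>v. h (f v) v) V W"
    unfolding bij_betw_def
  proof (intro conjI subset_antisym subsetI)
    show "inj_on (\<lambda>v. h (f v) v) V"
    proof (rule inj_onI)
      fix u v assume uv: "u \<in> V" "v \<in> V" "h (f u) u = h (f v) v"
      then have "f u = f v" using mem by metis
      with uv show "u = v"
        using bij_betw_imp_inj_on[OF h, of "f v"] by (auto dest: inj_onD)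
    qed
  next
    fix w assume "w \<in> W"
    then have "w \<in> h (g w) ` {v \<in> V. f v = g w}"
      using bij_betw_imp_surj_on[OF h, of "g w"] by blast
    then show "w \<in> (\<lambda>v. h (f v) v) ` V" by force
  qed (use mem in auto)
  with mem that show thesis by blast
qed

lemma bij_betw_transpose_comp:
  assumes "bij_betw \<phi> V W" "v \<in> V" "w \<in> W"
  shows "bij_betw (transpose w (\<phi> v) \<circ> \<phi>) V W"
proof (rule bij_betw_trans[OF assms(1)])
  have "\<phi> v \<in> W" using assms by (auto dest: bij_betwE)
  then show "bij_betw (transpose w (\<phi> v)) W W"
    using \<open>w \<in> W\<close> by (simp add: bij_betw_def)
qed

text \<open>A fibrewise bijection is corrected by two transpositions. Each exchanges points with the
  same \<open>g\<close>-value, so fibres are preserved.\<close>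

lemma ex_bij_betw_fibres_two_points:
  assumes "finite V" "finite W"
    and "\<And>c. card {v \<in> V. f v = c} = card {w \<in> W. g w = c}"
    and "a \<in> V" "a' \<in> W" "f a = g a'"
    and "b \<in> V" "b' \<in> W" "f b = g b'"
    and "a \<noteq> b" "a' \<noteq> b'"
  obtains \<phi> where "bij_betw \<phi> V W" "\<And>v. v \<in> V \<Longrightarrow> g (\<phi> v) = f v" "\<phi> a = a'" "\<phi> b = b'"
proof -
  obtain \<phi> where \<phi>: "bij_betw \<phi> V W" "\<And>v. v \<in> V \<Longrightarrow> g (\<phi> v) = f v"
    using ex_bij_betw_fibres[OF assms(1-3)] by blast
  define \<phi>1 where "\<phi>1 = transpose a' (\<phi> a) \<circ> \<phi>"
  have \<phi>1: "bij_betw \<phi>1 V W" "\<phi>1 a = a'"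
    using bij_betw_transpose_comp[OF \<phi>(1)] assms by (auto simp: \<phi>1_def)
  have g1: "g (\<phi>1 v) = f v" if "v \<in> V" for v
    using \<phi>(2)[OF that] \<phi>(2)[OF \<open>a \<in> V\<close>] assms by (auto simp: \<phi>1_def transpose_def)
  define \<phi>2 where "\<phi>2 = transpose b' (\<phi>1 b) \<circ> \<phi>1"
  \<comment> \<open>The second transposition exchanges \<open>b'\<close> and
    \<open>\<phi>1 b\<close>. Both differ from \<open>a'\<close>, so the value at \<open>a\<close>
    stays correct.\<close>
  have "\<phi>1 b \<noteq> a'"
    using \<phi>1 assms by (metis bij_betw_imp_inj_on inj_onD)
  then have "\<phi>2 a = a'" "\<phi>2 b = b'"
    using \<phi>1 assms by (auto simp: \<phi>2_def)
  moreover have "bij_betw \<phi>2 V W"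
    using bij_betw_transpose_comp[OF \<phi>1(1)] assms by (auto simp: \<phi>2_def)
  moreover have "g (\<phi>2 v) = f v" if "v \<in> V" for v
    using g1[OF that] g1[OF \<open>b \<in> V\<close>] assms by (auto simp: \<phi>2_def transpose_def)
  ultimately show thesis using that by blast
qed

section \<open>Intersection closures and faithful correspondences\<close>

lemma inter_closure_subset_Pow:
  assumes "F \<subseteq> Pow V"
  shows "inter_closure F \<subseteq> Pow V"
proof
  fix X assume "X \<in> inter_closure F"
  then show "X \<in> Pow V" using assms by induction auto
qed

lemma inter_closure_Inter:
  assumes "finite J" "J \<noteq> {}" "J \<subseteq> inter_closure F"
  shows "\<Inter>J \<in> inter_closure F"
  using assms by (induction rule: finite_ne_induct) (auto intro: inter_closure.inter)

lemma faithful_correspondence_Inter: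
  assumes "faithful_correspondence \<eta> F1 F2"
    and "finite J" "J \<noteq> {}" "J \<subseteq> inter_closure F1"
  shows "\<eta> (\<Inter>J) = \<Inter>(\<eta> ` J)"
  using assms(2-4)
proof (induction rule: finite_ne_induct)
  case (insert X J)
  then show ?case
    using assms(1) inter_closure_Inter[of J F1]
    by (simp add: faithful_correspondence_def)
qed simp

text \<open>Injectivity on \<open>V\<close> makes taking images commute with intersections of
  subsets of \<open>V\<close>, and all members of the closure are such subsets.\<close>

lemma inter_closure_image:
  assumes "inj_on f V" "F \<subseteq> Pow V"
  shows "inter_closure ((`) f ` F) = (`) f ` inter_closure F"
proof (intro subset_antisym subsetI)
  fix Y assume "Y \<in> inter_closure ((`) f ` F)"
  then show "Y \<in> (`) f ` inter_closure F"
  proof induction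
    case (base Y)
    then show ?case by (auto intro: inter_closure.base)
  next
    case (inter Y1 Y2)
    then obtain X1 X2 where X: "X1 \<in> inter_closure F" "X2 \<in> inter_closure F"
      and Y: "Y1 = f ` X1" "Y2 = f ` X2" by blast
    then have "Y1 \<inter> Y2 = f ` (X1 \<inter> X2)"
      using inter_closure_subset_Pow[OF assms(2)] inj_on_image_Int[OF assms(1)]
      by (metis PowD subsetD)
    then show ?case using X by (auto intro: inter_closure.inter)
  qed
next
  fix Y assume "Y \<in> (`) f ` inter_closure F"
  then obtain X where X: "X \<in> inter_closure F" and Y: "Y = f ` X" by blast
  from X have "f ` X \<in> inter_closure ((`) f ` F)"
  proof induction
    case (base X)
    then show ?case by (auto intro: inter_closure.base)
  next
    case (inter X1 X2)
    then have "f ` (X1 \<inter> X2) = f ` X1 \<inter> f ` X2"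
      using inter_closure_subset_Pow[OF assms(2)] inj_on_image_Int[OF assms(1)]
      by (metis PowD subsetD)
    with inter.IH show ?case by (simp add: inter_closure.inter)
  qed
  with Y show "Y \<in> inter_closure ((`) f ` F)" by simp
qed

lemma faithful_correspondence_image:
  assumes "inj_on f V" "F \<subseteq> Pow V"
  shows "faithful_correspondence ((`) f) F ((`) f ` F)"
  unfolding faithful_correspondence_def
proof (intro conjI ballI)
  note sub = inter_closure_subset_Pow[OF assms(2)]
  show "bij_betw ((`) f) (inter_closure F) (inter_closure ((`) f ` F))"
    unfolding inter_closure_image[OF assms]
    using sub inj_on_image_Pow[OF assms(1)] by (auto intro: inj_on_imp_bij_betw inj_on_subset)
  fix X assume X: "X \<in> inter_closure F"
  then have "X \<subseteq> V" using sub by auto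
  then show "X \<approx> f ` X"
    using assms(1) by (meson bij_betw_imageI eqpoll_def inj_on_subset)
  fix Y assume "Y \<in> inter_closure F"
  with X sub show "f ` (X \<inter> Y) = f ` X \<inter> f ` Y"
    by (intro inj_on_image_Int[OF assms(1)]) auto
qed

section \<open>Upper cones\<close>

text \<open>The cones of \<open>Z1\<close> and \<open>Z2\<close> meet in the cone of
  \<open>Z1 \<union> Z2\<close>. A faithful correspondence may send an out-neighbourhood to any
  member of the closure, not only to a generator, so all members must be recognised as
  cones.\<close>

lemma inter_closure_upper_cones:
  assumes "Y \<in> inter_closure (upper_cone n ` R)" "R \<subseteq> Pow {..<n}"
  shows "\<exists>Z \<subseteq> {..<n}. Y = upper_cone n Z"
  using assms(1)
proof induction
  case (base Y)
  then show ?case using assms(2) by auto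
next
  case (inter Y1 Y2)
  then obtain Z1 Z2 where "Z1 \<subseteq> {..<n}" "Y1 = upper_cone n Z1"
    "Z2 \<subseteq> {..<n}" "Y2 = upper_cone n Z2" by blast
  then show ?case
    by (intro exI[of _ "Z1 \<union> Z2"]) (auto simp: upper_cone_def)
qed

text \<open>A cone of size \<open>2 ^ n\<close> is the whole power set and so contains
  \<open>{}\<close>. The full cone is thus detected by its size, which a faithful correspondence
  preserves.\<close>

lemma upper_cone_full_iff:
  "card (upper_cone n Z) = 2 ^ n \<longleftrightarrow> Z = {}"
proof
  assume "card (upper_cone n Z) = 2 ^ n"
  then have "upper_cone n Z = Pow {..<n}"
    by (intro card_subset_eq) (auto simp: upper_cone_def card_Pow)
  then have "{} \<in> upper_cone n Z" by simp
  then show "Z = {}" by (simp add: upper_cone_def)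
qed (simp add: upper_cone_def card_Pow flip: Pow_def)

section \<open>Cone labellings\<close>

text \<open>\<open>\<psi>\<close> names the vertices by subsets of \<open>{..<n}\<close>, and
  \<open>\<rho>\<close> is a result function read on vertices. The last clause reflects that results
  at \<open>{}\<close> and at the whole background set are empty.\<close>

definition cone_labelling ::
    "'a pair_pre_digraph \<Rightarrow> nat \<Rightarrow> ('a \<Rightarrow> nat set) \<Rightarrow> ('a \<Rightarrow> nat set) \<Rightarrow> bool" where
  "cone_labelling G n \<psi> \<rho> \<longleftrightarrow>
     bij_betw \<psi> (pverts G) (Pow {..<n}) \<and>
     (\<forall>u \<in> pverts G. \<rho> u \<subseteq> {..<n}) \<and>
     (\<forall>u \<in> pverts G. \<forall>v \<in> pverts G. (u, v) \<in> parcs G \<longleftrightarrow> \<rho> u \<subseteq> \<psi> v) \<and>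
     (\<forall>u \<in> pverts G. \<psi> u = {} \<or> \<psi> u = {..<n} \<longrightarrow> \<rho> u = {})"

section \<open>Digraph isomorphisms as vertex bijections\<close>

text \<open>\<open>digraph_iso\<close> carries a separate arc map. Since both graphs have the ends
  \<open>fst\<close> and \<open>snd\<close>, that map must send \<open>(u, v)\<close> to
  \<open>(\<phi> u, \<phi> v)\<close>.\<close>

lemma digraph_iso_with_projD:
  assumes "digraph_iso (with_proj G) (with_proj H)"
  obtains \<phi> where "bij_betw \<phi> (pverts G) (pverts H)"
    and "\<And>u v. u \<in> pverts G \<Longrightarrow> v \<in> pverts G \<Longrightarrow>
      (u, v) \<in> parcs G \<longleftrightarrow> (\<phi> u, \<phi> v) \<in> parcs H"
proof -
  obtain f where hom: "pre_digraph.digraph_isomorphism (with_proj G) f"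
    and H: "with_proj H = app_iso f (with_proj G)"
    using assms by (auto simp: digraph_iso_def)
  define \<phi> where "\<phi> = iso_verts f"
  have ends: "iso_tail f = fst" "iso_head f = snd"
    and verts: "pverts H = \<phi> ` pverts G" and arcs: "parcs H = iso_arcs f ` parcs G"
    using H by (auto simp: with_proj_def app_iso_def \<phi>_def)
  have inj: "inj_on \<phi> (pverts G)" and wf: "wf_digraph (with_proj G)"
    and map: "\<forall>e \<in> parcs G. iso_arcs f e = (\<phi> (fst e), \<phi> (snd e))"
    using hom by (auto simp: pre_digraph.digraph_isomorphism_def ends \<phi>_def prod_eq_iff)
  have "(u, v) \<in> parcs G \<longleftrightarrow> (\<phi> u, \<phi> v) \<in> parcs H"
    if uv: "u \<in> pverts G" "v \<in> pverts G" for u v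
  proof
    assume "(u, v) \<in> parcs G"
    then show "(\<phi> u, \<phi> v) \<in> parcs H" using map arcs by force
  next
    assume "(\<phi> u, \<phi> v) \<in> parcs H"
    then obtain u' v' where e: "(u', v') \<in> parcs G" "\<phi> u = \<phi> u'" "\<phi> v = \<phi> v'"
      using map arcs by auto
    then have "u' \<in> pverts G" "v' \<in> pverts G"
      using wf_digraph.wellformed[OF wf, of "(u', v')"] by auto
    with e uv inj show "(u, v) \<in> parcs G" by (auto dest: inj_onD)
  qed
  moreover have "bij_betw \<phi> (pverts G) (pverts H)"
    using inj verts by (simp add: bij_betw_def)
  ultimately show thesis using that by blast
qed

text \<open>The arc map is \<open>map_prod \<phi> \<phi>\<close>. Well-formedness of
  \<open>G\<close> makes it injective on arcs, that of \<open>H\<close> makes it reach every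
  arc.\<close>

lemma digraph_iso_with_projI:
  assumes "pair_wf_digraph G" "pair_wf_digraph H"
    and bij: "bij_betw \<phi> (pverts G) (pverts H)"
    and arcs: "\<And>u v. u \<in> pverts G \<Longrightarrow> v \<in> pverts G \<Longrightarrow>
      (u, v) \<in> parcs G \<longleftrightarrow> (\<phi> u, \<phi> v) \<in> parcs H"
  shows "digraph_iso (with_proj G) (with_proj H)"
proof -
  interpret G: pair_wf_digraph G by fact
  interpret H: pair_wf_digraph H by fact
  define f where "f = \<lparr>iso_verts = \<phi>, iso_arcs = map_prod \<phi> \<phi>, iso_head = snd, iso_tail = fst\<rparr>"
  have "inj_on \<phi> (pverts G)" and verts: "\<phi> ` pverts G = pverts H"
    using bij by (auto simp: bij_betw_def)
  then have "inj_on (map_prod \<phi> \<phi>) (pverts G \<times> pverts G)"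
    by (intro map_prod_inj_on)
  then have "inj_on (map_prod \<phi> \<phi>) (parcs G)"
    by (rule inj_on_subset) (auto dest: G.wellformed')
  then have "pre_digraph.digraph_isomorphism (with_proj G) f"
    using \<open>inj_on \<phi> (pverts G)\<close> G.wf_digraph_axioms
    by (simp add: pre_digraph.digraph_isomorphism_def f_def)
  moreover have "map_prod \<phi> \<phi> ` parcs G = parcs H"
  proof (intro subset_antisym subsetI)
    fix e assume "e \<in> map_prod \<phi> \<phi> ` parcs G"
    then show "e \<in> parcs H" using arcs by (auto dest: G.wellformed')
  next
    fix e assume e: "e \<in> parcs H"
    then have "e \<in> \<phi> ` pverts G \<times> \<phi> ` pverts G"
      by (cases e) (auto simp: verts dest: H.wellformed')
    then obtain u v where "u \<in> pverts G" "v \<in> pverts G" "e = (\<phi> u, \<phi> v)" by auto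
    with e arcs show "e \<in> map_prod \<phi> \<phi> ` parcs G" by force
  qed
  then have "with_proj H = app_iso f (with_proj G)"
    using verts by (simp add: with_proj_def app_iso_def f_def)
  ultimately show ?thesis by (auto simp: digraph_iso_def)
qed

section \<open>Result functions, and labellings versus transition graphs\<close>

lemma res_subset:
  assumes "reaction_system (S, A)"
  shows "res (S, A) X \<subseteq> S"
proof -
  have "res_reaction a X \<subseteq> S" if "a \<in> A" for a
    using assms that by (cases a) auto
  then show ?thesis by auto
qed

text \<open>Nonempty reactants keep every reaction from being enabled in \<open>{}\<close>.\<close>

lemma res_empty:
  assumes "reaction_system (S, A)"
  shows "res (S, A) {} = {}"
proof -
  have "res_reaction a {} = {}" if "a \<in> A" for a
  proof -
    obtain R I P where a: "a = (R, I, P)" by (cases a)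
    then have "R \<noteq> {}" "I \<noteq> {}" "I \<subseteq> S" using assms that by auto
    then show ?thesis using a by auto
  qed
  then show ?thesis by auto
qed

text \<open>Inhibitors form a nonempty subset of \<open>S\<close>, so they block every reaction in
  \<open>S\<close>.\<close>

lemma res_full:
  assumes "reaction_system (S, A)"
  shows "res (S, A) S = {}"
proof -
  have "res_reaction a S = {}" if "a \<in> A" for a
  proof -
    obtain R I P where a: "a = (R, I, P)" by (cases a)
    then have "R \<noteq> {}" "I \<noteq> {}" "I \<subseteq> S" using assms that by auto
    then show ?thesis using a by auto
  qed
  then show ?thesis by auto
qed

text \<open>The isomorphism is followed by an enumeration \<open>h\<close> of \<open>S\<close>;
  \<open>\<rho> u\<close> is the image under \<open>h\<close> of the result at
  \<open>\<phi> u\<close>.\<close>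

lemma cone_labelling_if_iso:
  fixes G :: "'a pair_pre_digraph" and S :: "'s set"
  assumes sys: "reaction_system (S, A)"
    and iso: "digraph_iso (with_proj G) (with_proj (transition_graph (S, A)))"
  shows "\<exists>\<psi> \<rho>. cone_labelling G (card S) \<psi> \<rho>"
proof -
  have verts: "pverts (transition_graph (S, A)) = Pow S" by simp
  obtain \<phi> where \<phi>: "bij_betw \<phi> (pverts G) (Pow S)"
    and arcs: "\<And>u v. u \<in> pverts G \<Longrightarrow> v \<in> pverts G \<Longrightarrow>
      (u, v) \<in> parcs G \<longleftrightarrow> (\<phi> u, \<phi> v) \<in> parcs (transition_graph (S, A))"
    using digraph_iso_with_projD[OF iso] unfolding verts by blast
  have \<phi>_sub: "\<phi> u \<subseteq> S" if "u \<in> pverts G" for u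
    using bij_betwE[OF \<phi>] that by blast
  have "finite S" using sys by simp
  then obtain h where h: "bij_betw h S {..<card S}"
    using ex_bij_betw_finite_nat by (metis atLeast0LessThan)
  have inj: "inj_on h S" and img: "h ` S = {..<card S}"
    using h by (auto simp: bij_betw_def)
  define \<psi> where "\<psi> u = h ` \<phi> u" for u
  define \<rho> where "\<rho> u = h ` res (S, A) (\<phi> u)" for u
  have "bij_betw ((`) h \<circ> \<phi>) (pverts G) (Pow {..<card S})"
    using bij_betw_trans[OF \<phi> bij_betw_Pow[OF h]] .
  then have "bij_betw \<psi> (pverts G) (Pow {..<card S})"
    by (simp add: \<psi>_def[abs_def] comp_def)
  moreover have "\<rho> u \<subseteq> {..<card S}" for u
    unfolding \<rho>_def using img res_subset[OF sys] by blast
  moreover have "(u, v) \<in> parcs G \<longleftrightarrow> \<rho> u \<subseteq> \<psi> v" if "u \<in> pverts G" "v \<in> pverts G" for u v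
  proof -
    have "\<rho> u \<subseteq> \<psi> v \<longleftrightarrow> res (S, A) (\<phi> u) \<subseteq> \<phi> v"
      unfolding \<rho>_def \<psi>_def
      using inj_on_image_mem_iff[OF inj _ \<phi>_sub[OF that(2)]] res_subset[OF sys, of "\<phi> u"]
      by blast
    then show ?thesis using arcs[OF that] \<phi>_sub that by simp
  qed
  moreover have "\<rho> u = {}" if "u \<in> pverts G" "\<psi> u = {} \<or> \<psi> u = {..<card S}" for u
  proof -
    have "\<phi> u = {} \<or> \<phi> u = S"
      using that \<phi>_sub[OF that(1)] inj_on_image_eq_iff[OF inj, of "\<phi> u" S] img
      by (auto simp: \<psi>_def)
    then show ?thesis
      using res_empty[OF sys] res_full[OF sys] by (auto simp: \<rho>_def simp del: res.simps)
  qed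
  ultimately have "cone_labelling G (card S) \<psi> \<rho>"
    unfolding cone_labelling_def by simp
  then show ?thesis by blast
qed

text \<open>For \<open>Y \<subseteq> S\<close> the reaction \<open>(Y, S - Y, f Y)\<close> is
  enabled in exactly one subset of \<open>S\<close>, namely \<open>Y\<close>, so the values can be
  prescribed one by one.\<close>

lemma ex_reaction_system_res:
  assumes "finite S" "\<And>X. X \<subseteq> S \<Longrightarrow> f X \<subseteq> S" "f {} = {}" "f S = {}"
  obtains A where "reaction_system (S, A)" "\<And>X. X \<subseteq> S \<Longrightarrow> res (S, A) X = f X"
proof -
  \<comment> \<open>\<open>{}\<close> and \<open>S\<close> are left out, as they would give empty
    reactants or inhibitors; the prescribed values there are empty anyway.\<close>
  define A where "A = (\<lambda>X. (X, S - X, f X)) ` (Pow S - {{}, S})"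
  have "reaction_system (S, A)"
    using assms by (auto simp: A_def)
  moreover have "res (S, A) X = f X" if "X \<subseteq> S" for X
  proof -
    have enabled_iff: "enabled (Y, S - Y, f Y) X \<longleftrightarrow> Y = X" if "Y \<subseteq> S" for Y
      using that \<open>X \<subseteq> S\<close> by auto
    have "res (S, A) X = (\<Union>Y\<in>Pow S - {{}, S}. if Y = X then f Y else {})"
      using enabled_iff by (simp add: A_def)
    also have "\<dots> = f X"
      using that assms(3,4) by (auto split: if_splits)
    finally show ?thesis .
  qed
  ultimately show thesis using that by blast
qed

lemma iso_if_cone_labelling:
  assumes wf: "pair_wf_digraph G" and lab: "cone_labelling G n \<psi> \<rho>"
  obtains A where "reaction_system ({..<n}, A)"
    "digraph_iso (with_proj G) (with_proj (transition_graph ({..<n}, A)))"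
proof -
  have \<psi>: "bij_betw \<psi> (pverts G) (Pow {..<n})"
    and \<rho>: "\<And>u. u \<in> pverts G \<Longrightarrow> \<rho> u \<subseteq> {..<n}"
    and arcs: "\<And>u v. u \<in> pverts G \<Longrightarrow> v \<in> pverts G \<Longrightarrow> (u, v) \<in> parcs G \<longleftrightarrow> \<rho> u \<subseteq> \<psi> v"
    and ends: "\<And>u. u \<in> pverts G \<Longrightarrow> \<psi> u = {} \<or> \<psi> u = {..<n} \<Longrightarrow> \<rho> u = {}"
    using lab by (auto simp: cone_labelling_def)
  \<comment> \<open>With \<open>\<psi>\<close> as the isomorphism, this is the result function to be
    realised. The last clause of the labelling makes it empty at \<open>{}\<close> and
    \<open>{..<n}\<close>.\<close>
  define f where "f X = \<rho> (inv_into (pverts G) \<psi> X)" for X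
  have inv: "inv_into (pverts G) \<psi> X \<in> pverts G" "\<psi> (inv_into (pverts G) \<psi> X) = X"
    if "X \<subseteq> {..<n}" for X
    using that \<psi> by (auto simp: bij_betw_def inv_into_into f_inv_into_f)
  have f\<psi>: "f (\<psi> u) = \<rho> u" if "u \<in> pverts G" for u
    using that \<psi> by (simp add: f_def bij_betw_inv_into_left)
  obtain A where sys: "reaction_system ({..<n}, A)"
    and res: "\<And>X. X \<subseteq> {..<n} \<Longrightarrow> res ({..<n}, A) X = f X"
    using ex_reaction_system_res[of "{..<n}" f] inv \<rho> ends unfolding f_def
    by (metis empty_subsetI finite_lessThan order_refl)
  have "digraph_iso (with_proj G) (with_proj (transition_graph ({..<n}, A)))"
  proof (rule digraph_iso_with_projI[OF wf, where \<phi> = \<psi>])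
    show "pair_wf_digraph (transition_graph ({..<n}, A))"
      by unfold_locales auto
    show "bij_betw \<psi> (pverts G) (pverts (transition_graph ({..<n}, A)))"
      using \<psi> by simp
    fix u v assume uv: "u \<in> pverts G" "v \<in> pverts G"
    then have "\<psi> u \<subseteq> {..<n}" "\<psi> v \<subseteq> {..<n}" using bij_betwE[OF \<psi>] by blast+
    then show "(u, v) \<in> parcs G \<longleftrightarrow> (\<psi> u, \<psi> v) \<in> parcs (transition_graph ({..<n}, A))"
      using arcs[OF uv] res[of "\<psi> u"] f\<psi>[OF uv(1)] by (simp del: res.simps)
  qed
  with sys that show thesis by blast
qed

section \<open>From a labelling to the three conditions\<close>

lemma out_set_subset:
  assumes "pair_wf_digraph G"
  shows "out_set G v \<subseteq> pverts G"
  using pair_wf_digraph.wellformed'[OF assms] by (auto simp: out_set_def)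

text \<open>Images under \<open>\<psi>\<close> turn out-neighbourhoods into cones and so give the
  correspondence, with \<open>R\<close> the set of all \<open>\<rho> u\<close>. The special vertices
  are those labelled \<open>{}\<close>, which lies only in the full cone, and \<open>{..<n}\<close>,
  which lies in every cone.\<close>

lemma conditions_if_cone_labelling:
  assumes wf: "pair_wf_digraph G" and lab: "cone_labelling G n \<psi> \<rho>"
  shows "card (pverts G) = 2 ^ n"
    and "\<exists>R \<eta>. R \<subseteq> Pow {..<n} \<and>
      faithful_correspondence \<eta> (out_sets G) (upper_cone n ` R)"
    and "\<exists>v_bot v_top.
       v_bot \<in> pverts G - \<Union>{X \<in> out_sets G. X \<noteq> pverts G} \<and>
       v_top \<in> pverts G \<and> v_top \<in> \<Inter>(out_sets G) \<and>
       (v_bot, v_bot) \<in> parcs G \<and> (v_top, v_bot) \<in> parcs G"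
proof -
  have \<psi>: "bij_betw \<psi> (pverts G) (Pow {..<n})"
    and \<rho>: "\<And>u. u \<in> pverts G \<Longrightarrow> \<rho> u \<subseteq> {..<n}"
    and arcs: "\<And>u v. u \<in> pverts G \<Longrightarrow> v \<in> pverts G \<Longrightarrow> (u, v) \<in> parcs G \<longleftrightarrow> \<rho> u \<subseteq> \<psi> v"
    and ends: "\<And>u. u \<in> pverts G \<Longrightarrow> \<psi> u = {} \<or> \<psi> u = {..<n} \<Longrightarrow> \<rho> u = {}"
    using lab by (auto simp: cone_labelling_def)
  have inj: "inj_on \<psi> (pverts G)" and img: "\<psi> ` pverts G = Pow {..<n}"
    using \<psi> by (auto simp: bij_betw_def)
  show "card (pverts G) = 2 ^ n"
    using bij_betw_same_card[OF \<psi>] by (simp add: card_Pow)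
  have out: "out_set G u = {v \<in> pverts G. \<rho> u \<subseteq> \<psi> v}" if "u \<in> pverts G" for u
    using arcs[OF that] out_set_subset[OF wf, of u] by (auto simp: out_set_def)
  have cone: "\<psi> ` out_set G u = upper_cone n (\<rho> u)" if "u \<in> pverts G" for u
    unfolding out[OF that] upper_cone_def img[symmetric] by auto
  have "out_sets G \<subseteq> Pow (pverts G)"
    using out_set_subset[OF wf] by (auto simp: out_sets_def)
  from faithful_correspondence_image[OF inj this]
  have "faithful_correspondence ((`) \<psi>) (out_sets G) (upper_cone n ` \<rho> ` pverts G)"
    by (simp add: out_sets_def image_image cone cong: image_cong)
  moreover have "\<rho> ` pverts G \<subseteq> Pow {..<n}" using \<rho> by auto
  ultimately show "\<exists>R \<eta>. R \<subseteq> Pow {..<n} \<and>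
      faithful_correspondence \<eta> (out_sets G) (upper_cone n ` R)" by blast
  have "{} \<in> \<psi> ` pverts G" "{..<n} \<in> \<psi> ` pverts G" using img by auto
  then obtain b t where b: "b \<in> pverts G" "\<psi> b = {}" and t: "t \<in> pverts G" "\<psi> t = {..<n}"
    by (metis imageE)
  have "out_set G u = pverts G" if "u \<in> pverts G" "b \<in> out_set G u" for u
    using that b by (auto simp: out)
  then have "b \<in> pverts G - \<Union>{X \<in> out_sets G. X \<noteq> pverts G}"
    using b by (auto simp: out_sets_def)
  moreover have "t \<in> \<Inter>(out_sets G)"
    using t \<rho> by (auto simp: out_sets_def out)
  \<comment> \<open>Arcs into \<open>b\<close>, whose label is \<open>{}\<close>, require
    \<open>\<rho> b\<close> and \<open>\<rho> t\<close> to be empty; the last clause of the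
    labelling provides this.\<close>
  moreover have "(b, b) \<in> parcs G" "(t, b) \<in> parcs G"
    using b t ends arcs by auto
  ultimately show "\<exists>v_bot v_top.
       v_bot \<in> pverts G - \<Union>{X \<in> out_sets G. X \<noteq> pverts G} \<and>
       v_top \<in> pverts G \<and> v_top \<in> \<Inter>(out_sets G) \<and>
       (v_bot, v_bot) \<in> parcs G \<and> (v_top, v_bot) \<in> parcs G"
    using t by blast
qed

section \<open>From the three conditions to a labelling\<close>

text \<open>For nonempty \<open>J\<close> both sides are sizes of intersections, and
  \<open>\<eta>\<close> maps one to the other. For \<open>J = {}\<close> the sets are
  \<open>V\<close> and \<open>W\<close> themselves, whose sizes agree by assumption.\<close>

lemma card_inters_eq_if_faithful:
  assumes corr: "faithful_correspondence \<eta> F1 F2"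
    and "finite V" "card V = card W" "F1 \<subseteq> Pow V" "F2 \<subseteq> Pow W" "J \<subseteq> F1"
  shows "card {v \<in> V. \<forall>X\<in>J. v \<in> X} = card {w \<in> W. \<forall>X\<in>J. w \<in> \<eta> X}"
proof (cases "J = {}")
  case False
  have "finite J"
    using assms by (meson finite_Pow_iff finite_subset)
  have J: "J \<subseteq> inter_closure F1"
    using \<open>J \<subseteq> F1\<close> by (auto intro: inter_closure.base)
  note mem = inter_closure_Inter[OF \<open>finite J\<close> False J]
  have "\<eta> X \<in> inter_closure F2" if "X \<in> J" for X
    using corr J that by (auto simp: faithful_correspondence_def dest: bij_betwE)
  then have \<eta>J: "\<eta> X \<subseteq> W" if "X \<in> J" for X
    using inter_closure_subset_Pow[OF \<open>F2 \<subseteq> Pow W\<close>] that by blast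
  have "\<Inter>J \<approx> \<eta> (\<Inter>J)"
    using corr mem by (simp add: faithful_correspondence_def)
  then have "card (\<Inter>J) = card (\<Inter>(\<eta> ` J))"
    unfolding faithful_correspondence_Inter[OF corr \<open>finite J\<close> False J]
    by (auto simp: eqpoll_def bij_betw_same_card)
  moreover have "{v \<in> V. \<forall>X\<in>J. v \<in> X} = \<Inter>J"
    using False assms(4,6) by blast
  moreover have "{w \<in> W. \<forall>X\<in>J. w \<in> \<eta> X} = \<Inter>(\<eta> ` J)"
    using False \<eta>J by blast
  ultimately show ?thesis by simp
qed (simp add: assms)

text \<open>Vertices and labels get patterns indexed by the out-neighbourhoods \<open>X\<close>:
  membership in \<open>X\<close> and in \<open>\<eta> X\<close>. A bijection respecting patterns
  turns \<open>(u, v) \<in> parcs G\<close> into membership of \<open>\<psi> v\<close> in the cone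
  \<open>\<eta> (out_set G u)\<close>.\<close>

lemma cone_labelling_if_conditions:
  assumes wf: "pair_wf_digraph G" and "n \<ge> 1" and card: "card (pverts G) = 2 ^ n"
    and R: "R \<subseteq> Pow {..<n}"
    and corr: "faithful_correspondence \<eta> (out_sets G) (upper_cone n ` R)"
    and b: "b \<in> pverts G - \<Union>{X \<in> out_sets G. X \<noteq> pverts G}"
    and t: "t \<in> pverts G" "t \<in> \<Inter>(out_sets G)"
    and bb: "(b, b) \<in> parcs G" and tb: "(t, b) \<in> parcs G"
  shows "\<exists>\<psi> \<rho>. cone_labelling G n \<psi> \<rho>"
proof -
  let ?V = "pverts G" and ?W = "Pow {..<n}" and ?F = "out_sets G"
  have finV: "finite ?V" using card by (metis card.infinite power_not_zero zero_neq_numeral)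
  have F: "?F \<subseteq> Pow ?V"
    using out_set_subset[OF wf] by (auto simp: out_sets_def)
  have cones: "upper_cone n ` R \<subseteq> Pow ?W" by (auto simp: upper_cone_def)
  have out_mem: "out_set G u \<in> ?F" if "u \<in> ?V" for u
    using that by (simp add: out_sets_def)
  have clo: "\<eta> X \<in> inter_closure (upper_cone n ` R)" if "X \<in> ?F" for X
    using corr that
    by (auto simp: faithful_correspondence_def intro: inter_closure.base dest: bij_betwE)
  have card_\<eta>: "card (\<eta> X) = card X" if "X \<in> ?F" for X
    using corr inter_closure.base[OF that]
    by (metis bij_betw_same_card eqpoll_def faithful_correspondence_def)
  have "\<exists>Z \<subseteq> {..<n}. \<eta> (out_set G u) = upper_cone n Z" if "u \<in> ?V" for u
    using inter_closure_upper_cones[OF clo[OF out_mem[OF that]] R] .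
  then obtain \<rho> where \<rho>: "\<And>u. u \<in> ?V \<Longrightarrow> \<rho> u \<subseteq> {..<n}"
    and \<eta>\<rho>: "\<And>u. u \<in> ?V \<Longrightarrow> \<eta> (out_set G u) = upper_cone n (\<rho> u)"
    by metis
  \<comment> \<open>\<open>\<eta>\<close> preserves size and both ambient sets have
    \<open>2 ^ n\<close> elements, so full out-neighbourhoods correspond to full cones.\<close>
  have full: "\<rho> u = {} \<longleftrightarrow> out_set G u = ?V" if "u \<in> ?V" for u
  proof -
    have "\<rho> u = {} \<longleftrightarrow> card (out_set G u) = card ?V"
      using card_\<eta>[OF out_mem[OF that]] upper_cone_full_iff[of n "\<rho> u"] \<eta>\<rho>[OF that] card by simp
    also have "\<dots> \<longleftrightarrow> out_set G u = ?V"
      using card_subset_eq[OF finV out_set_subset[OF wf]] by auto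
    finally show ?thesis .
  qed
  \<comment> \<open>\<open>b\<close> avoids every out-neighbourhood other than the whole vertex
    set.\<close>
  have bot: "b \<in> out_set G u \<longleftrightarrow> \<rho> u = {}" if "u \<in> ?V" for u
    using b full[OF that] out_mem[OF that] by auto
  have \<rho>bt: "\<rho> b = {}" "\<rho> t = {}"
    using bot b t bb tb by (auto simp: out_set_def)

  define f where "f v = {X \<in> ?F. v \<in> X}" for v
  define g where "g w = {X \<in> ?F. w \<in> \<eta> X}" for w
  \<comment> \<open>The fibre over \<open>c\<close> consists of the points in all sets of
    \<open>c\<close> and in no other set of the family. If \<open>c\<close> is not contained in
    \<open>?F\<close>, both fibres are empty.\<close>
  have fibres: "card {v \<in> ?V. f v = c} = card {w \<in> ?W. g w = c}" for c
  proof (cases "c \<subseteq> ?F")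
    case True
    have "card {v \<in> ?V. (\<forall>X\<in>c. v \<in> X) \<and> (\<forall>X\<in>?F - c. v \<notin> X)}
        = card {w \<in> ?W. (\<forall>X\<in>c. w \<in> \<eta> X) \<and> (\<forall>X\<in>?F - c. w \<notin> \<eta> X)}"
    proof (rule card_pattern_eq[where I = ?F])
      show "finite (?F - c)" using finV by (simp add: out_sets_def)
      show "card {v \<in> ?V. \<forall>X\<in>J. v \<in> X} = card {w \<in> ?W. \<forall>X\<in>J. w \<in> \<eta> X}" if "J \<subseteq> ?F" for J
        using card_inters_eq_if_faithful[OF corr finV _ F cones that] card
        by (simp add: card_Pow)
    qed (use finV True in auto)
    moreover have "f v = c \<longleftrightarrow> (\<forall>X\<in>c. v \<in> X) \<and> (\<forall>X\<in>?F - c. v \<notin> X)" for v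
      using True by (auto simp: f_def)
    moreover have "g w = c \<longleftrightarrow> (\<forall>X\<in>c. w \<in> \<eta> X) \<and> (\<forall>X\<in>?F - c. w \<notin> \<eta> X)" for w
      using True by (auto simp: g_def)
    ultimately show ?thesis by simp
  next
    case False
    then have "{v \<in> ?V. f v = c} = {}" "{w \<in> ?W. g w = c} = {}"
      by (auto simp: f_def g_def)
    then show ?thesis by (simp only: card.empty)
  qed
  \<comment> \<open>\<open>b\<close> lies in exactly the full out-neighbourhoods, \<open>{}\<close>
    in exactly the full cones.\<close>
  have fg_b: "f b = g {}"
  proof -
    have "b \<in> out_set G u \<longleftrightarrow> {} \<in> \<eta> (out_set G u)" if "u \<in> ?V" for u
      using bot[OF that] \<eta>\<rho>[OF that] by (simp add: upper_cone_def)
    then show ?thesis by (auto simp: f_def g_def out_sets_def)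
  qed
  \<comment> \<open>\<open>t\<close> lies in every out-neighbourhood and \<open>{..<n}\<close> in
    every cone, so both patterns are all of \<open>?F\<close>.\<close>
  have fg_t: "f t = g {..<n}"
    using t \<eta>\<rho> \<rho> by (auto simp: f_def g_def out_sets_def upper_cone_def)

  obtain \<psi> where \<psi>: "bij_betw \<psi> ?V ?W" and g\<psi>: "\<And>v. v \<in> ?V \<Longrightarrow> g (\<psi> v) = f v"
    and ends: "\<And>u. u \<in> ?V \<Longrightarrow> \<psi> u = {} \<or> \<psi> u = {..<n} \<Longrightarrow> \<rho> u = {}"
  proof (cases "b = t")
    case True
    \<comment> \<open>Then \<open>b\<close> lies in every out-neighbourhood, so all of them are full and any labelling works.\<close>
    then have "\<rho> u = {}" if "u \<in> ?V" for u
      using bot[OF that] t out_mem[OF that] by blast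
    then show thesis
      using ex_bij_betw_fibres[OF finV _ fibres] that by (metis finite_Pow_iff finite_lessThan)
  next
    case False
    \<comment> \<open>Prescribing two values needs distinct targets; this is where
      \<open>n \<ge> 1\<close> enters.\<close>
    have "{} \<noteq> {..<n}" using \<open>n \<ge> 1\<close> lessThan_empty_iff[of n] by force
    with False obtain \<psi> where \<psi>: "bij_betw \<psi> ?V ?W" "\<And>v. v \<in> ?V \<Longrightarrow> g (\<psi> v) = f v"
      and \<psi>bt: "\<psi> b = {}" "\<psi> t = {..<n}"
      using ex_bij_betw_fibres_two_points[OF finV _ fibres _ _ fg_b _ _ fg_t] b t
      by auto
    \<comment> \<open>By injectivity the two extreme labels occur only at \<open>b\<close> and
      \<open>t\<close>, where \<open>\<rho>\<close> is known to be empty.\<close>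
    have "\<rho> u = {}" if "u \<in> ?V" "\<psi> u = {} \<or> \<psi> u = {..<n}" for u
    proof -
      have "u = b \<or> u = t"
        using that b t \<psi>bt bij_betw_imp_inj_on[OF \<psi>(1)] by (metis DiffD1 inj_onD)
      then show ?thesis using \<rho>bt by auto
    qed
    with \<psi> that show thesis by blast
  qed
  have "(u, v) \<in> parcs G \<longleftrightarrow> \<rho> u \<subseteq> \<psi> v" if uv: "u \<in> ?V" "v \<in> ?V" for u v
  proof -
    have "(u, v) \<in> parcs G \<longleftrightarrow> out_set G u \<in> f v"
      using out_mem[OF uv(1)] by (simp add: f_def out_set_def)
    also have "\<dots> \<longleftrightarrow> \<psi> v \<in> upper_cone n (\<rho> u)"
      using out_mem[OF uv(1)] \<eta>\<rho>[OF uv(1)] by (simp add: g\<psi>[OF uv(2), symmetric] g_def)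
    also have "\<dots> \<longleftrightarrow> \<rho> u \<subseteq> \<psi> v"
      using bij_betwE[OF \<psi>] uv(2) by (auto simp: upper_cone_def)
    finally show ?thesis .
  qed
  then have "cone_labelling G n \<psi> \<rho>"
    unfolding cone_labelling_def using \<psi> \<rho> ends by simp
  then show ?thesis by blast
qed

text \<open>Cone labellings link the two sides. Going forward \<open>n\<close> is
  \<open>card S\<close>, going back \<open>S\<close> is \<open>{..<n}\<close>, so
  \<open>S \<noteq> {}\<close> matches \<open>n \<ge> 1\<close>.\<close>

theorem theorem5p6:
  fixes G :: "'a pair_pre_digraph"
  assumes "pair_wf_digraph G"
  shows "(\<exists>(S :: nat set) A. reaction_system (S, A) \<and> S \<noteq> {} \<and>
            digraph_iso (with_proj G) (with_proj (transition_graph (S, A))))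
    \<longleftrightarrow>
    (\<exists>n \<ge> 1. card (pverts G) = 2 ^ n \<and>
       (\<exists>R \<eta>. R \<subseteq> Pow {..<n} \<and>
          faithful_correspondence \<eta> (out_sets G) (upper_cone n ` R))) \<and>
    (\<exists>v_bot v_top.
       v_bot \<in> pverts G - \<Union>{X \<in> out_sets G. X \<noteq> pverts G} \<and>
       v_top \<in> pverts G \<and> v_top \<in> \<Inter>(out_sets G) \<and>
       (v_bot, v_bot) \<in> parcs G \<and> (v_top, v_bot) \<in> parcs G)"
    (is "?iso \<longleftrightarrow> ?corr \<and> ?ends")
proof
  assume ?iso
  then obtain S :: "nat set" and A where sys: "reaction_system (S, A)" and "S \<noteq> {}"
    and iso: "digraph_iso (with_proj G) (with_proj (transition_graph (S, A)))" by blast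
  obtain \<psi> \<rho> where "cone_labelling G (card S) \<psi> \<rho>"
    using cone_labelling_if_iso[OF sys iso] by blast
  note conds = conditions_if_cone_labelling[OF assms this]
  have "card S \<ge> 1"
    using sys \<open>S \<noteq> {}\<close> by (simp add: Suc_le_eq card_gt_0_iff)
  with conds(1,2) have ?corr by blast
  with conds(3) show "?corr \<and> ?ends" by blast
next
  assume "?corr \<and> ?ends"
  then obtain n R \<eta> b t where "n \<ge> 1" and cond: "card (pverts G) = 2 ^ n" "R \<subseteq> Pow {..<n}"
    "faithful_correspondence \<eta> (out_sets G) (upper_cone n ` R)"
    "b \<in> pverts G - \<Union>{X \<in> out_sets G. X \<noteq> pverts G}"
    "t \<in> pverts G" "t \<in> \<Inter>(out_sets G)" "(b, b) \<in> parcs G" "(t, b) \<in> parcs G"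
    by (elim conjE exE)
  obtain \<psi> \<rho> where "cone_labelling G n \<psi> \<rho>"
    using cone_labelling_if_conditions[OF assms \<open>n \<ge> 1\<close> cond] by blast
  then obtain A where "reaction_system ({..<n}, A)"
    "digraph_iso (with_proj G) (with_proj (transition_graph ({..<n}, A)))"
    using iso_if_cone_labelling[OF assms] by blast
  moreover have "{..<n} \<noteq> {}"
    using \<open>n \<ge> 1\<close> by (auto simp: lessThan_empty_iff)
  ultimately show ?iso by blast
qed

end
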